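(* For every integer $m\ge1$ and every $\beta\in\mathbb{C}$ with $\mathfrak{Re}(\beta)\ge1$, $$I_{0^+}^m\left[x^{\beta-1}\log\Gamma(x)\right](1)=\int_{0}^{1}\int_{0}^{t_1}\cdots\int_{0}^{t_{m-1}}t_m^{\beta-1}\log\Gamma(t_m)\,dt_m\cdots dt_2\,dt_1=\frac{1}{(m-1)!}\sum_{n=0}^{m-1}(-1)^n\binom{m-1}{n}\Gamma(n+\beta)\,I_{1^-}^{n+\beta}\log\Gamma(0).$$
   Context: $\Gamma$ is Euler's gamma function and $\log\Gamma(t)$ is the real logarithm for $t\in(0,1]$. For $\mathfrak{Re}(\alpha)>0$ the left- and right-sided Riemann-Liouville fractional integrals of order $\alpha$ of $f$ on $[a,b]$ are $I_{a^+}^\alpha f(x)=\frac{1}{\Gamma(\alpha)}\int_a^x (x-t)^{\alpha-1}f(t)\,dt$ ($a<x\le b$) and $I_{b^-}^\alpha f(x)=\frac{1}{\Gamma(\alpha)}\int_x^b (t-x)^{\alpha-1}f(t)\,dt$ ($a\le x<b$). Here $a=0$, $b=1$ (and the same formulas are used for complex-valued $f$ on $(0,1)$), so $I_{0^+}^m[f(x)](1)=\frac{1}{(m-1)!}\int_0^1(1-t)^{m-1}f(t)\,dt$ and $I_{1^-}^{s}\log\Gamma(0)=\frac{1}{\Gamma(s)}\int_0^1 t^{s-1}\log\Gamma(t)\,dt$. For positive real $y$ and complex $s$, $y^s=e^{s\log y}$. For $m=1$ the repeated integral is $\int_0^1 t_1^{\beta-1}\log\Gamma(t_1)\,dt_1$.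 *)

theory Defs
  imports "HOL-Analysis.Analysis"
begin

text \<open>
  The integrals are Lebesgue integrals over open intervals: \<open>powr\<close> satisfies \<open>0 powr s = 0\<close> even
  for \<open>s = 0\<close>, so the endpoints are left out to keep the usual value of the kernel.
  For \<open>u > 0\<close>, \<open>complex_of_real u powr s\<close> is \<open>exp (s * ln u)\<close>.
\<close>

definition RL_integral_left ::
    "real \<Rightarrow> complex \<Rightarrow> (real \<Rightarrow> complex) \<Rightarrow> real \<Rightarrow> complex" where
  "RL_integral_left a \<alpha> f x =
     1 / Gamma \<alpha> *
     (LINT t:{a<..<x}|lebesgue. complex_of_real (x - t) powr (\<alpha> - 1) * f t)"

definition RL_integral_right ::
    "real \<Rightarrow> complex \<Rightarrow> (real \<Rightarrow> complex) \<Rightarrow> real \<Rightarrow> complex" where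
  "RL_integral_right b \<alpha> f x =
     1 / Gamma \<alpha> *
     (LINT t:{x<..<b}|lebesgue. complex_of_real (t - x) powr (\<alpha> - 1) * f t)"

text \<open>
  \<open>iterated_integral a m f x\<close> is the \<open>m\<close>-fold integral of \<open>f t\<^sub>m\<close> where the outermost variable
  \<open>t\<^sub>1\<close> runs from \<open>a\<close> to \<open>x\<close> and each further \<open>t\<^sub>i\<close> from \<open>a\<close> to the preceding variable.
\<close>

primrec iterated_integral ::
    "real \<Rightarrow> nat \<Rightarrow> (real \<Rightarrow> complex) \<Rightarrow> real \<Rightarrow> complex" where
  "iterated_integral a 0 f x = f x"
| "iterated_integral a (Suc m) f x = (LINT t:{a<..<x}|lebesgue. iterated_integral a m f t)"

end

theory Submission
  imports Defs
begin

text \<open>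
  Write \<open>g t = t powr (\<beta> - 1) * ln (Gamma t)\<close> and \<open>m = k + 1\<close>. All three quantities are equal to
  the moment \<open>J / k!\<close>, where \<open>J\<close> is the integral of \<open>(1 - t) ^ k * g t\<close> over the unit interval.

  For the fractional integral this is its definition, because the kernel exponent is a natural
  number and \<open>Gamma (k + 1) = k!\<close>. For the iterated integral it is Cauchy's formula for repeated
  integration (\<open>cauchy_repeated_integration\<close>): by induction, one more integration multiplies the
  kernel \<open>(t - s) ^ k\<close> by the indicator of the triangle \<open>a < s < t < x\<close>, and exchanging the order of
  integration leaves the elementary integral of \<open>(t - s) ^ k\<close> over \<open>s < t < x\<close>. For the sum, expand
  \<open>(1 - t) ^ k\<close> by the binomial theorem; the factor \<open>t ^ n\<close> raises the exponent of \<open>t\<close> to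
  \<open>n + \<beta> - 1\<close>, and the resulting integral is the right-sided integral of order \<open>n + \<beta>\<close> at \<open>0\<close>
  without its normalising factor \<open>1 / Gamma (n + \<beta>)\<close>.

  Each of these steps is legitimate because \<open>g\<close> is absolutely integrable
  (\<open>set_integrable_powr_ln_Gamma\<close>): near \<open>0\<close> the function \<open>ln (Gamma t)\<close> grows only like
  \<open>- ln t\<close>, hence more slowly than any negative power of \<open>t\<close>.
\<close>

section \<open>Cauchy's formula for repeated integration\<close>

text \<open>
  Product measurability and Fubini's theorem are used over Borel sets, whereas the integrals of
  interest are over the completed measure; for Borel integrands the two integrals agree.
\<close>
lemma set_integral_lebesgue_eq_lborel:
  fixes f :: "real \<Rightarrow> complex"
  assumes "set_borel_measurable lborel A f" and [measurable]: "A \<in> sets borel"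
  shows "(LINT t:A|lebesgue. f t) = (LINT t:A|lborel. f t)"
  using assms unfolding set_lebesgue_integral_def set_borel_measurable_def
  by (intro integral_completion) auto

lemma set_integral_power_shift:
  fixes s x :: real
  assumes "s \<le> x"
  shows "(LINT t:{s<..<x}|lborel. (t - s) ^ k) = (x - s) ^ Suc k / Suc k"
proof -
  have "(LINT t:{s<..<x}|lborel. (t - s) ^ k) = (LINT t:{s..x}|lborel. (t - s) ^ k)"
    unfolding set_lebesgue_integral_def
    by (intro integral_cong_AE) (use AE_lborel_singleton[of s] AE_lborel_singleton[of x] in
        \<open>auto simp: indicator_def elim!: eventually_elim2\<close>)
  also have "\<dots> = (x - s) ^ Suc k / Suc k - (s - s) ^ Suc k / Suc k"
    unfolding set_lebesgue_integral_def
  proof (rule integral_FTC_atLeastAtMost[OF assms])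
    fix t
    show "((\<lambda>t. (t - s) ^ Suc k / Suc k) has_vector_derivative (t - s) ^ k) (at t within {s..x})"
      unfolding has_real_derivative_iff_has_vector_derivative[symmetric]
      by (rule derivative_eq_intros refl | simp add: field_simps del: of_nat_Suc)+
  qed (intro continuous_intros)
  finally show ?thesis by simp
qed

text \<open>
  On the triangle \<open>a < s < t < x\<close> the kernel \<open>(t - s) ^ k\<close> is at most \<open>(x - a) ^ k\<close>, so the integrand
  is dominated by a constant times \<open>h s\<close> on the strip \<open>a < t < x\<close> of finite width.
\<close>
lemma triangle_kernel_integrable:
  fixes h :: "real \<Rightarrow> complex"
  assumes h: "integrable lborel h"
  shows "integrable (lborel \<Otimes>\<^sub>M lborel)
           (\<lambda>(t, s). indicator {a<..<x} t * (indicator {a<..<t} s * (of_real (t - s) ^ k * h s)))"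
proof -
  have [measurable]: "h \<in> borel_measurable borel"
    using borel_measurable_integrable[OF h] by simp
  have "integrable (lborel \<Otimes>\<^sub>M lborel)
          (\<lambda>(t, s). indicator {a<..<x} t * (of_real ((x - a) ^ k) * h s))"
  proof (rule lborel_pair.Fubini_integrable)
    have norm_eq: "norm (case (t, s) of (t, s) \<Rightarrow> indicator {a<..<x} t * (of_real ((x - a) ^ k) * h s)) =
        indicator {a<..<x} t * norm (of_real ((x - a) ^ k) * h s)" for t s
      by (auto simp: indicator_def)
    have "integrable lborel (indicat_real {a<..<x})"
      by (cases "a \<le> x") (auto intro!: integrable_real_indicator)
    then show "integrable lborel (\<lambda>t. \<integral>s. norm (case (t, s) of (t, s) \<Rightarrow>
        indicator {a<..<x} t * (of_real ((x - a) ^ k) * h s)) \<partial>lborel)"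
      unfolding norm_eq by (simp only: integral_mult_right_zero) (rule integrable_mult_left)
  qed (use h in \<open>auto\<close>)
  then show ?thesis
  proof (rule Bochner_Integration.integrable_bound)
    show "AE p in lborel \<Otimes>\<^sub>M lborel. norm (case p of (t, s) \<Rightarrow>
            indicator {a<..<x} t * (indicator {a<..<t} s * (of_real (t - s) ^ k * h s)))
          \<le> norm (case p of (t, s) \<Rightarrow> indicator {a<..<x} t * (of_real ((x - a) ^ k) * h s))"
      by (auto simp: indicator_def norm_mult norm_power simp del: of_real_diff
               intro!: AE_I2 mult_right_mono power_mono)
  qed (simp add: split_beta' indicator_def)
qed

text \<open>
  The induction step of Cauchy's formula. After the order of integration is exchanged, \<open>h s\<close> comes
  out of the inner integral and only the kernel is integrated over \<open>s < t < x\<close>.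
\<close>
lemma triangle_kernel_integral:
  fixes h :: "real \<Rightarrow> complex"
  assumes h: "integrable lborel h"
  shows "(LINT t:{a<..<x}|lborel. LINT s:{a<..<t}|lborel. of_real (t - s) ^ k * h s) =
         (LINT s:{a<..<x}|lborel. of_real (x - s) ^ Suc k * h s) / of_nat (Suc k)"
proof -
  let ?f = "\<lambda>t s. indicator {a<..<x} t * (indicator {a<..<t} s * (of_real (t - s) ^ k * h s))"
  have swap: "indicator {a<..<x} t * (indicator {a<..<t} s * (of_real (t - s) ^ k * h s)) =
              (indicator {a<..<x} s * h s) * of_real (indicator {s<..<x} t * (t - s) ^ k)" for t s
    by (auto simp: indicator_def)
  have "(LINT t:{a<..<x}|lborel. LINT s:{a<..<t}|lborel. of_real (t - s) ^ k * h s) =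
        (\<integral>t. \<integral>s. ?f t s \<partial>lborel \<partial>lborel)"
    unfolding set_lebesgue_integral_def by (simp add: scaleR_conv_of_real of_real_indicator)
  also have "\<dots> = (\<integral>s. \<integral>t. ?f t s \<partial>lborel \<partial>lborel)"
    by (rule lborel_pair.Fubini_integral[symmetric]) (rule triangle_kernel_integrable[OF h])
  also have "\<dots> = (\<integral>s. (indicator {a<..<x} s * h s) *
                     of_real (LINT t:{s<..<x}|lborel. (t - s) ^ k) \<partial>lborel)"
    unfolding swap set_lebesgue_integral_def
    by (simp only: integral_mult_right_zero integral_complex_of_real real_scaleR_def)
  also have "\<dots> = (\<integral>s. (indicator {a<..<x} s *\<^sub>R (of_real (x - s) ^ Suc k * h s)) / of_nat (Suc k) \<partial>lborel)"
    by (intro Bochner_Integration.integral_cong refl)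
       (auto simp: indicator_def set_integral_power_shift simp del: of_nat_Suc power_Suc)
  finally show ?thesis
    unfolding set_lebesgue_integral_def by simp
qed

text \<open>
  The end point \<open>x\<close> varies in the induction, since the induction hypothesis is needed at every
  value of the outer integration variable; \<open>b\<close> only bounds the region where \<open>g\<close> is integrable.
\<close>
theorem cauchy_repeated_integration:
  assumes g: "set_integrable lborel {a<..<b} g" and "x \<le> b"
  shows "iterated_integral a (Suc k) g x =
         (LINT s:{a<..<x}|lborel. of_real (x - s) ^ k * g s) / fact k"
  using \<open>x \<le> b\<close>
proof (induction k arbitrary: x)
  case 0
  have "set_integrable lborel {a<..<x} g"
    using g by (rule set_integrable_subset) (use 0 in auto)
  then have "set_borel_measurable lborel {a<..<x} g"
    by (simp add: set_integrable_def set_borel_measurable_def)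
  then show ?case
    by (simp add: set_integral_lebesgue_eq_lborel)
next
  case (Suc k)
  \<comment> \<open>Extending \<open>g\<close> by zero gives a function that is integrable on the whole line.\<close>
  define h where "h = (\<lambda>s. indicator {a<..<b} s *\<^sub>R g s)"
  have h: "integrable lborel h"
    using g by (simp add: h_def set_integrable_def)
  have [measurable]: "h \<in> borel_measurable borel"
    using borel_measurable_integrable[OF h] by simp
  have gh: "(LINT s:{a<..<t}|lborel. of_real (t - s) ^ n * g s) =
            (LINT s:{a<..<t}|lborel. of_real (t - s) ^ n * h s)" if "t \<le> b" for t n
    using that by (intro set_lebesgue_integral_cong) (auto simp: h_def)
  let ?F = "\<lambda>t. (LINT s:{a<..<t}|lborel. of_real (t - s) ^ k * h s) / fact k"
  have F: "?F \<in> borel_measurable borel"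
    unfolding set_lebesgue_integral_def by (simp add: indicator_def)
  have "iterated_integral a (Suc (Suc k)) g x = (LINT t:{a<..<x}|lebesgue. ?F t)"
    unfolding iterated_integral.simps(2)[of a "Suc k"]
    using Suc.prems gh by (intro set_lebesgue_integral_cong) (auto simp: Suc.IH simp del: iterated_integral.simps)
  also have "\<dots> = (LINT t:{a<..<x}|lborel. ?F t)"
    using F by (intro set_integral_lebesgue_eq_lborel) (auto simp: set_borel_measurable_def)
  also have "\<dots> = (LINT s:{a<..<x}|lborel. of_real (x - s) ^ Suc k * h s) / of_nat (Suc k) / fact k"
    by (simp only: set_integral_divide_zero triangle_kernel_integral[OF h])
  also have "\<dots> = (LINT s:{a<..<x}|lborel. of_real (x - s) ^ Suc k * g s) / fact (Suc k)"
    using Suc.prems by (simp only: gh) (simp add: field_simps)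
  finally show ?case .
qed

text \<open>
  With exponent \<open>0\<close> and base \<open>0\<close> the complex power is \<open>0\<close> but the natural power is \<open>1\<close>. On the
  open interval the base \<open>x - s\<close> is positive, so the two kernels agree there for every \<open>k\<close>.
\<close>
lemma RL_integral_left_Suc_eq:
  assumes g: "set_integrable lborel {a<..<x} g"
  shows "RL_integral_left a (of_nat (Suc k)) g x =
         (LINT s:{a<..<x}|lborel. of_real (x - s) ^ k * g s) / fact k"
proof -
  have "(\<lambda>s. indicator {a<..<x} s *\<^sub>R g s) \<in> borel_measurable lborel"
    using g unfolding set_integrable_def by (rule borel_measurable_integrable)
  then have "(\<lambda>s. of_real (x - s) ^ k * (indicator {a<..<x} s *\<^sub>R g s)) \<in> borel_measurable lborel"
    by (intro borel_measurable_times) auto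
  then have meas: "set_borel_measurable lborel {a<..<x} (\<lambda>s. of_real (x - s) ^ k * g s)"
    by (simp add: set_borel_measurable_def)
  have "(LINT s:{a<..<x}|lebesgue. complex_of_real (x - s) powr (of_nat (Suc k) - 1) * g s) =
        (LINT s:{a<..<x}|lebesgue. of_real (x - s) ^ k * g s)"
    by (intro set_lebesgue_integral_cong) (auto simp: powr_nat simp del: of_real_diff)
  also have "\<dots> = (LINT s:{a<..<x}|lborel. of_real (x - s) ^ k * g s)"
    using meas by (rule set_integral_lebesgue_eq_lborel) simp
  moreover have "Gamma (of_nat (Suc k) :: complex) = fact k"
    using Gamma_fact[of k, where 'a = complex] by (simp add: add_ac)
  ultimately show ?thesis
    by (simp only: RL_integral_left_def) simp
qed

section \<open>Integrability of the kernel\<close>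

text \<open>
  The functional equation \<open>Gamma (t + 1) = t * Gamma t\<close> splits \<open>ln (Gamma t)\<close> into
  \<open>ln (Gamma (t + 1))\<close>, which is continuous on the closed unit interval and hence bounded, and
  \<open>- ln t = ln (1 / t)\<close>, which is at most \<open>(1 / t) powr e / e\<close> for every \<open>e > 0\<close>.
\<close>
lemma abs_ln_Gamma_le:
  "\<exists>C::real. \<forall>t e. 0 < t \<and> t < 1 \<and> 0 < e \<longrightarrow> \<bar>ln (Gamma t)\<bar> \<le> C + t powr (- e) / e"
proof -
  have "continuous_on {0..1::real} (\<lambda>t. ln (Gamma (t + 1)))"
    by (intro continuous_intros continuous_on_compose2[OF continuous_on_Gamma[of "{0<..}"]])
       (auto elim!: nonpos_Ints_cases simp: less_imp_neq[OF Gamma_real_pos, symmetric])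
  then have "bounded ((\<lambda>t. ln (Gamma (t + 1))) ` {0..1::real})"
    by (intro compact_imp_bounded compact_continuous_image) auto
  then obtain C where C: "\<And>t. 0 \<le> t \<Longrightarrow> t \<le> 1 \<Longrightarrow> \<bar>ln (Gamma (t + 1 :: real))\<bar> \<le> C"
    unfolding bounded_iff by (metis atLeastAtMost_iff imageI real_norm_def)
  show ?thesis
  proof (intro exI[of _ C] allI impI)
    fix t e :: real assume "0 < t \<and> t < 1 \<and> 0 < e"
    then have t: "0 < t" "t < 1" and e: "0 < e" by auto
    have "Gamma (t + 1) = t * Gamma t"
      using t by (intro Gamma_plus1) (auto elim!: nonpos_Ints_cases)
    then have "ln (Gamma t) = ln (Gamma (t + 1)) - ln t"
      using t less_imp_neq[OF Gamma_real_pos[of t]] by (simp add: ln_mult)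
    moreover have "ln (1 / t) \<le> (1 / t) powr e / e"
      using t e by (intro ln_powr_bound) auto
    then have "\<bar>ln t\<bar> \<le> t powr (- e) / e"
      using t by (simp add: ln_div powr_divide powr_minus field_simps)
    ultimately show "\<bar>ln (Gamma t)\<bar> \<le> C + t powr (- e) / e"
      using C[of t] t by linarith
  qed
qed

lemma set_integrable_powr_0_1:
  assumes "c > - 1"
  shows "set_integrable lborel {0<..<1} (\<lambda>t. t powr c :: real)"
proof -
  have "(\<lambda>t. t powr c) absolutely_integrable_on {0..1::real}"
    using assms by (intro nonnegative_absolutely_integrable_1 integrable_on_powr_from_0) auto
  then have "(\<lambda>t. t powr c) absolutely_integrable_on {0<..<1::real}"
    by (rule set_integrable_subset) auto
  then show ?thesis
    unfolding set_integrable_def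
    by (subst (asm) integrable_completion) auto
qed

text \<open>
  The exponent \<open>Re z - 1\<close> exceeds \<open>- 1\<close> by \<open>Re z\<close>. Half of this margin pays for the growth of
  \<open>ln (Gamma t)\<close> at \<open>0\<close>, and the other half keeps the bound integrable.
\<close>
lemma set_integrable_powr_ln_Gamma:
  assumes z: "Re z > 0"
  shows "set_integrable lborel {0<..<1}
           (\<lambda>t. complex_of_real t powr (z - 1) * complex_of_real (ln (Gamma t)))"
proof -
  define e where "e = Re z / 2"
  have e: "e > 0" "Re z = 2 * e" using z by (auto simp: e_def)
  obtain C :: real where
    C: "\<forall>t e. 0 < t \<and> t < 1 \<and> 0 < e \<longrightarrow> \<bar>ln (Gamma t)\<bar> \<le> C + t powr (- e) / e"
    using abs_ln_Gamma_le by (elim exE)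
  have "set_integrable lborel {0<..<1} (\<lambda>t. C * t powr (2 * e - 1) + t powr (e - 1) / e :: real)"
    using e by (intro set_integral_add(1) set_integrable_mult_right set_integrable_divide
                      set_integrable_powr_0_1) auto
  then show ?thesis
  proof (rule set_integrable_bound)
    have "continuous_on {0<..<1} (\<lambda>t. complex_of_real t powr (z - 1) * complex_of_real (ln (Gamma t)))"
      by (intro continuous_intros)
         (auto elim!: nonpos_Ints_cases simp: less_imp_neq[OF Gamma_real_pos, symmetric])
    then show "set_borel_measurable lborel {0<..<1}
        (\<lambda>t. complex_of_real t powr (z - 1) * complex_of_real (ln (Gamma t)))"
      unfolding set_borel_measurable_def
      by (simp add: borel_measurable_continuous_on_indicator)
    show "AE t in lborel. t \<in> {0<..<1} \<longrightarrow>
        norm (complex_of_real t powr (z - 1) * complex_of_real (ln (Gamma t)))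
        \<le> norm (C * t powr (2 * e - 1) + t powr (e - 1) / e)"
    proof (intro AE_I2 impI)
      fix t :: real assume "t \<in> {0<..<1}"
      then have t: "0 < t" "t < 1" by auto
      have "norm (complex_of_real t powr (z - 1) * complex_of_real (ln (Gamma t))) =
            t powr (2 * e - 1) * \<bar>ln (Gamma t)\<bar>"
        using t e by (simp add: norm_mult norm_powr_real_powr)
      also have "\<dots> \<le> t powr (2 * e - 1) * (C + t powr (- e) / e)"
        using C t e(1) by (intro mult_left_mono) auto
      also have "\<dots> = C * t powr (2 * e - 1) + t powr (e - 1) / e"
        using powr_add[of t "2 * e - 1" "- e"] by (simp add: algebra_simps)
      finally show "norm (complex_of_real t powr (z - 1) * complex_of_real (ln (Gamma t)))
        \<le> norm (C * t powr (2 * e - 1) + t powr (e - 1) / e)"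
        by simp
    qed
  qed
qed

section \<open>Binomial expansion into right-sided integrals\<close>

lemma one_minus_power_binomial:
  "(1 - t) ^ k = (\<Sum>n = 0..k. (-1) ^ n * of_nat (k choose n) * t ^ n)"
  for t :: "'a :: comm_ring_1"
  using binomial_ring[of "- t" 1 k]
  by (simp add: power_minus[of t] atLeast0AtMost mult_ac)

lemma Gamma_mult_RL_integral_right_ln_Gamma:
  assumes z: "Re z > 0"
  shows "Gamma z * RL_integral_right 1 z (\<lambda>t. complex_of_real (ln (Gamma t))) 0 =
         (LINT t:{0<..<1}|lborel. complex_of_real t powr (z - 1) * complex_of_real (ln (Gamma t)))"
proof -
  have "z \<notin> \<int>\<^sub>\<le>\<^sub>0"
    using z by (auto elim!: nonpos_Ints_cases)
  then have "Gamma z \<noteq> 0"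
    by (simp add: Gamma_eq_zero_iff)
  moreover have "set_borel_measurable lborel {0<..<1}
       (\<lambda>t. complex_of_real t powr (z - 1) * complex_of_real (ln (Gamma t)))"
    using set_integrable_powr_ln_Gamma[OF z]
    by (simp add: set_integrable_def set_borel_measurable_def)
  ultimately show ?thesis
    by (simp add: RL_integral_right_def set_integral_lebesgue_eq_lborel)
qed

lemma binomial_moments:
  fixes z :: complex
  assumes z: "Re z > 0"
  shows "(LINT t:{0<..<1}|lborel. of_real (1 - t) ^ k *
            (complex_of_real t powr (z - 1) * complex_of_real (ln (Gamma t)))) =
         (\<Sum>n = 0..k. (-1) ^ n * of_nat (k choose n) *
            (LINT t:{0<..<1}|lborel. complex_of_real t powr (of_nat n + z - 1) * complex_of_real (ln (Gamma t))))"
    (is "(LINT t:_|_. _ * (_ * ?L t)) = _")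
proof -
  let ?M = "\<lambda>n t. complex_of_real t powr (of_nat n + z - 1) * ?L t"
  let ?c = "\<lambda>n. (-1) ^ n * of_nat (k choose n) :: complex"
  have int: "set_integrable lborel {0<..<1} (?M n)" for n
    using z by (intro set_integrable_powr_ln_Gamma) auto
  have shift: "complex_of_real t ^ n * complex_of_real t powr (z - 1) = of_real t powr (of_nat n + z - 1)"
    if "t > 0" for t n
    using that powr_add[of "complex_of_real t" "of_nat n" "z - 1"] by (simp add: powr_nat add_diff_eq)
  have "(LINT t:{0<..<1}|lborel. of_real (1 - t) ^ k * (complex_of_real t powr (z - 1) * ?L t)) =
        (LINT t:{0<..<1}|lborel. \<Sum>n = 0..k. ?c n * ?M n t)"
  proof (intro set_lebesgue_integral_cong allI impI)
    fix t :: real assume "t \<in> {0<..<1}"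
    then have M: "?c n * ?M n t = ?c n * of_real t ^ n * (of_real t powr (z - 1) * ?L t)" for n
      using shift[of t n, symmetric] by simp
    then show "of_real (1 - t) ^ k * (complex_of_real t powr (z - 1) * ?L t) = (\<Sum>n = 0..k. ?c n * ?M n t)"
      by (simp only: M of_real_diff of_real_1 one_minus_power_binomial sum_distrib_right)
  qed simp
  also have "\<dots> = (\<Sum>n = 0..k. LINT t:{0<..<1}|lborel. ?c n * ?M n t)"
    using int unfolding set_lebesgue_integral_def scaleR_sum_right
    by (intro Bochner_Integration.integral_sum)
       (auto intro!: set_integrable_mult_right simp flip: set_integrable_def)
  finally show ?thesis by simp
qed

theorem corollary3p1:
  fixes m :: nat and \<beta> :: complex
  assumes "m \<ge> 1" and "Re \<beta> \<ge> 1"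
  shows "RL_integral_left 0 (of_nat m)
           (\<lambda>x. complex_of_real x powr (\<beta> - 1) * complex_of_real (ln (Gamma x))) 1
         = iterated_integral 0 m
             (\<lambda>t. complex_of_real t powr (\<beta> - 1) * complex_of_real (ln (Gamma t))) 1
       \<and> iterated_integral 0 m
           (\<lambda>t. complex_of_real t powr (\<beta> - 1) * complex_of_real (ln (Gamma t))) 1
         = 1 / fact (m - 1) *
           (\<Sum>n = 0..m - 1. (-1) ^ n * of_nat ((m - 1) choose n) * Gamma (of_nat n + \<beta>) *
              RL_integral_right 1 (of_nat n + \<beta>) (\<lambda>t. complex_of_real (ln (Gamma t))) 0)"
proof -
  obtain k where m: "m = Suc k"
    using \<open>m \<ge> 1\<close> by (cases m) auto
  have pos: "Re \<beta> > 0" using \<open>Re \<beta> \<ge> 1\<close> by simp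
  let ?g = "\<lambda>t. complex_of_real t powr (\<beta> - 1) * complex_of_real (ln (Gamma t))"
  let ?J = "LINT s:{0<..<1}|lborel. of_real (1 - s) ^ k * ?g s"
  have g: "set_integrable lborel {0<..<1} ?g"
    using pos by (rule set_integrable_powr_ln_Gamma)
  have left: "RL_integral_left 0 (of_nat m) ?g 1 = ?J / fact k"
    unfolding m by (rule RL_integral_left_Suc_eq[OF g])
  have iter: "iterated_integral 0 m ?g 1 = ?J / fact k"
    unfolding m by (rule cauchy_repeated_integration[OF g order_refl])
  have "?J = (\<Sum>n = 0..k. (-1) ^ n * of_nat (k choose n) * Gamma (of_nat n + \<beta>) *
              RL_integral_right 1 (of_nat n + \<beta>) (\<lambda>t. complex_of_real (ln (Gamma t))) 0)"
    unfolding binomial_moments[OF pos]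
  proof (rule sum.cong[OF refl])
    fix n
    have "Re (of_nat n + \<beta>) > 0" using pos by simp
    from Gamma_mult_RL_integral_right_ln_Gamma[OF this, symmetric]
    show "(-1) ^ n * of_nat (k choose n) *
            (LINT t:{0<..<1}|lborel. complex_of_real t powr (of_nat n + \<beta> - 1) * complex_of_real (ln (Gamma t))) =
          (-1) ^ n * of_nat (k choose n) * Gamma (of_nat n + \<beta>) *
            RL_integral_right 1 (of_nat n + \<beta>) (\<lambda>t. complex_of_real (ln (Gamma t))) 0"
      by (simp only: mult.assoc)
  qed
  then show ?thesis
    using left iter by (simp add: m)
qed

end
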